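(* Let $m,p,q\geq 1$ be integers. Then the following identity of formal power series in $x$ holds: $$x^{2m+p} (1-x^p)(1-x^q)F^{(m)}(x)F^{(m+p)}(x)F^{(m+p+q)}(x) = x^m (1-x)(1-x^p) F^{(m)}(x)F^{(m+p+q)}(x) - (1-x)^2 \left(F^{(m+p)}(x) - F^{(m)}(x)\right).$$ In particular, $$x^{2m+1} F^{(m)}(x)F^{(m+1)}(x)F^{(m+2)}(x) = x^m F^{(m)}(x)F^{(m+2)}(x) - F^{(m+1)}(x) + F^{(m)}(x).$$
   Context: For each integer $m\ge 1$, $F^{(m)}(x)=\dfrac{x}{1-x-x^2-\cdots-x^m}=\sum_{n\ge0}F_n^{(m)}x^n$ is the ordinary generating function of the Fibonacci $m$-step numbers, defined by $F_n^{(m)}=0$ for $n=-(m-2),\ldots,0$ (with $F_0^{(1)}=0$ when $m=1$), $F_1^{(m)}=1$, and $F_n^{(m)}=\sum_{j=1}^m F_{n-j}^{(m)}$ for all $n\ge 2$. *)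

theory Defs
  imports Complex_Main "HOL-Computational_Algebra.Formal_Power_Series"
begin

text \<open>
  The Fibonacci \<open>m\<close>-step numbers, indexed by integers so that the recurrence can be written without
  truncated subtraction. The initial zeros are extended to all nonpositive indices;
  for \<open>n \<ge> 2\<close> and all \<open>1 \<le> j \<le> m\<close> only indices \<open>n - j \<ge> -(m - 2)\<close> are ever used.
\<close>
function fib_step :: "nat \<Rightarrow> int \<Rightarrow> int" where
  "fib_step m n =
     (if n \<le> 0 then 0
      else if n = 1 then 1
      else (\<Sum>j = 1..m. fib_step m (n - int j)))"
  by pat_completeness auto
termination
  by (relation "Wellfounded.measure (\<lambda>(m, n). nat n)") auto

declare fib_step.simps [simp del]

definition fib_gf :: "nat \<Rightarrow> int fps" where
  "fib_gf m = Abs_fps (\<lambda>n. fib_step m (int n))"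

text \<open>
  The closed form \<open>x / (1 - x - \<dots> - x^m)\<close>. The denominator has constant term \<open>1\<close>, so it is a unit
  in the integer power series and the following equation determines \<open>fib_gf m\<close>.
\<close>
lemma fib_gf_closed_form:
  "fib_gf m * (1 - (\<Sum>j = 1..m. fps_X ^ j)) = fps_X"
proof (rule fps_ext)
  fix n :: nat
  have conv: "fps_nth (fib_gf m * fps_X ^ j) n = fib_step m (int n - int j)" for j
    by (cases "n < j")
      (auto simp: fps_X_power_mult_right_nth fib_gf_def of_nat_diff fib_step.simps[of m "int n - int j"])
  have "fps_nth (fib_gf m * (1 - (\<Sum>j = 1..m. fps_X ^ j))) n
          = fib_step m (int n) - (\<Sum>j = 1..m. fib_step m (int n - int j))"
    by (simp add: algebra_simps sum_distrib_left fps_sum_nth conv)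
      (simp add: fib_gf_def)
  also have "\<dots> = fps_nth fps_X n"
  proof -
    have nonpos: "fib_step m k = 0" if "k \<le> 0" for k
      using that by (simp add: fib_step.simps)
    consider "n = 0" | "n = 1" | "n \<ge> 2" by linarith
    then show ?thesis
      by cases (simp_all add: nonpos fib_step.simps[of m "int n"] fib_step.simps[of m 1])
  qed
  finally show "fps_nth (fib_gf m * (1 - (\<Sum>j = 1..m. fps_X ^ j))) n = fps_nth fps_X n" .
qed

end

theory Submission imports Defs begin

text \<open>
  Multiplying the closed form of \<open>F\<^bsup>(m)\<^esup>\<close> by \<open>1 - x\<close> makes the geometric sum telescope, so that
  \<open>F\<^bsup>(m)\<^esup>(x) = x (1 - x) / (1 - 2 x + x\<^bsup>m+1\<^esup>)\<close>. The denominators for \<open>m\<close> and \<open>m + p\<close>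
  differ only in their last term, by \<open>x\<^bsup>m+1\<^esup> (1 - x\<^sup>p)\<close>; subtracting the two fractions therefore
  turns a difference of generating functions into their product (\<open>fib_gf_diff\<close>):
  \<open>(1 - x) (F\<^bsup>(m+p)\<^esup> - F\<^bsup>(m)\<^esup>) = x\<^sup>m (1 - x\<^sup>p) F\<^bsup>(m)\<^esup> F\<^bsup>(m+p)\<^esup>\<close>.

  The theorem is this rule used twice. Applied to the pair \<open>m\<close>, \<open>m + p\<close>, it rewrites the
  subtracted term so that the whole right-hand side becomes
  \<open>x\<^sup>m (1 - x\<^sup>p) F\<^bsup>(m)\<^esup>\<close> times \<open>(1 - x) (F\<^bsup>(m+p+q)\<^esup> - F\<^bsup>(m+p)\<^esup>)\<close>; applied to the pair
  \<open>m + p\<close>, \<open>m + p + q\<close>, it turns the last factor into the missing product. For \<open>p = q = 1\<close>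
  every term carries the factor \<open>(1 - x)\<^sup>2\<close>, which cancels because integer power series form
  an integral domain.
\<close>

lemma telescoped_denominator:
  "(1 - fps_X) * (1 - (\<Sum>j = 1..m. fps_X ^ j)) = 1 - 2 * fps_X + (fps_X ^ (m + 1) :: int fps)"
  by (induction m) (simp_all add: algebra_simps)

text \<open>
  Over a common denominator: \<open>D\<^sub>m = 1 - 2 x + x\<^bsup>m+1\<^esup>\<close> satisfies \<open>F\<^bsup>(m)\<^esup> D\<^sub>m = x (1 - x)\<close>,
  hence \<open>x (1 - x) (F\<^bsup>(m+p)\<^esup> - F\<^bsup>(m)\<^esup>) = F\<^bsup>(m)\<^esup> F\<^bsup>(m+p)\<^esup> (D\<^sub>m - D\<^bsub>m+p\<^esub>)\<close>, and a
  factor \<open>x\<close> cancels.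
\<close>

lemma fib_gf_diff:
  "(1 - fps_X) * (fib_gf (m + p) - fib_gf m)
     = fps_X ^ m * (1 - fps_X ^ p) * fib_gf m * fib_gf (m + p)"
proof -
  define D where "D n = 1 - 2 * fps_X + (fps_X ^ (n + 1) :: int fps)" for n
  have gf_D: "fib_gf n * D n = fps_X * (1 - fps_X)" for n
  proof -
    have "fib_gf n * D n = (1 - fps_X) * (fib_gf n * (1 - (\<Sum>j = 1..n. fps_X ^ j)))"
      unfolding D_def telescoped_denominator[symmetric] by (simp only: mult_ac)
    then show ?thesis
      by (simp only: fib_gf_closed_form mult.commute)
  qed
  have "fps_X * ((1 - fps_X) * (fib_gf (m + p) - fib_gf m))
          = fib_gf (m + p) * (fps_X * (1 - fps_X)) - fib_gf m * (fps_X * (1 - fps_X))"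
    by (simp add: algebra_simps)
  also have "\<dots> = fib_gf (m + p) * (fib_gf m * D m) - fib_gf m * (fib_gf (m + p) * D (m + p))"
    by (simp only: gf_D)
  also have "\<dots> = fib_gf m * fib_gf (m + p) * (D m - D (m + p))"
    by (simp add: algebra_simps)
  also have "D m - D (m + p) = fps_X * (fps_X ^ m * (1 - fps_X ^ p))"
    by (simp add: D_def algebra_simps power_add)
  finally have "fps_X * ((1 - fps_X) * (fib_gf (m + p) - fib_gf m))
      = fps_X * (fps_X ^ m * (1 - fps_X ^ p) * fib_gf m * fib_gf (m + p))"
    by (simp only: mult_ac)
  then show ?thesis
    using fps_X_neq_zero by (metis mult_left_cancel)
qed

lemma fib_gf_triple_product:
  "fps_X ^ (2 * m + p) * (1 - fps_X ^ p) * (1 - fps_X ^ q)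
     * fib_gf m * fib_gf (m + p) * fib_gf (m + p + q)
   = fps_X ^ m * (1 - fps_X) * (1 - fps_X ^ p) * fib_gf m * fib_gf (m + p + q)
     - (1 - fps_X) ^ 2 * (fib_gf (m + p) - fib_gf m)"
proof -
  let ?c = "fps_X ^ m * (1 - fps_X ^ p) * fib_gf m :: int fps"
  have "fps_X ^ (2 * m + p) * (1 - fps_X ^ p) * (1 - fps_X ^ q)
          * fib_gf m * fib_gf (m + p) * fib_gf (m + p + q)
        = ?c * (fps_X ^ (m + p) * (1 - fps_X ^ q) * fib_gf (m + p) * fib_gf (m + p + q))"
    by (simp only: mult_2 mult_2_right power_add mult_ac)
  also have "\<dots> = ?c * ((1 - fps_X) * (fib_gf (m + p + q) - fib_gf (m + p)))"
    by (simp only: fib_gf_diff)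
  also have "\<dots> = fps_X ^ m * (1 - fps_X) * (1 - fps_X ^ p) * fib_gf m * fib_gf (m + p + q)
                  - (1 - fps_X) * (?c * fib_gf (m + p))"
    by (simp only: right_diff_distrib mult_ac)
  also have "?c * fib_gf (m + p) = (1 - fps_X) * (fib_gf (m + p) - fib_gf m)"
    by (simp only: fib_gf_diff)
  finally show ?thesis
    by (simp only: power2_eq_square mult.assoc)
qed

theorem theorem3p4:
  fixes m p q :: nat
  assumes "m \<ge> 1" and "p \<ge> 1" and "q \<ge> 1"
  shows "fps_X ^ (2 * m + p) * (1 - fps_X ^ p) * (1 - fps_X ^ q)
           * fib_gf m * fib_gf (m + p) * fib_gf (m + p + q)
         = fps_X ^ m * (1 - fps_X) * (1 - fps_X ^ p) * fib_gf m * fib_gf (m + p + q)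
           - (1 - fps_X) ^ 2 * (fib_gf (m + p) - fib_gf m)
         \<and> fps_X ^ (2 * m + 1) * fib_gf m * fib_gf (m + 1) * fib_gf (m + 2)
         = fps_X ^ m * fib_gf m * fib_gf (m + 2) - fib_gf (m + 1) + fib_gf m"
proof
  show "fps_X ^ (2 * m + p) * (1 - fps_X ^ p) * (1 - fps_X ^ q)
           * fib_gf m * fib_gf (m + p) * fib_gf (m + p + q)
         = fps_X ^ m * (1 - fps_X) * (1 - fps_X ^ p) * fib_gf m * fib_gf (m + p + q)
           - (1 - fps_X) ^ 2 * (fib_gf (m + p) - fib_gf m)"
    by (rule fib_gf_triple_product)
next
  let ?L = "fps_X ^ (2 * m + 1) * fib_gf m * fib_gf (m + 1) * fib_gf (m + 2)"
  let ?R = "fps_X ^ m * fib_gf m * fib_gf (m + 2) - fib_gf (m + 1) + fib_gf m"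
  have index: "m + 1 + 1 = m + 2"
    by simp
  have "(1 - fps_X) ^ 2 * ?L
      = fps_X ^ (2 * m + 1) * (1 - fps_X) * (1 - fps_X) * fib_gf m * fib_gf (m + 1) * fib_gf (m + 2)"
    by (simp only: power2_eq_square mult_ac)
  also have "\<dots> = fps_X ^ m * (1 - fps_X) * (1 - fps_X) * fib_gf m * fib_gf (m + 2)
           - (1 - fps_X) ^ 2 * (fib_gf (m + 1) - fib_gf m)"
    using fib_gf_triple_product[of m 1 1] by (simp only: power_one_right index)
  also have "\<dots> = (1 - fps_X) ^ 2 * ?R"
    by (simp add: power2_eq_square algebra_simps)
  finally have cancel: "(1 - fps_X) ^ 2 * ?L = (1 - fps_X) ^ 2 * ?R" .
  have "fps_nth (1 - fps_X :: int fps) 0 \<noteq> 0"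
    by simp
  then have "(1 - fps_X :: int fps) ^ 2 \<noteq> 0"
    by (metis fps_zero_nth power_eq_0_iff)
  with cancel show "?L = ?R"
    using mult_left_cancel by blast
qed

end
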